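(* Let $\mathcal H$ be a Hilbert lattice with lattice cone $S:=\mathcal H^+$, let $A\subseteq\mathcal H$ be a closed affine subspace with finite codimension, and suppose $S\cap A\neq\emptyset$. Let $Q$ denote the orthogonal projection of $\mathcal H$ onto the (finite-dimensional) orthogonal complement of the linear subspace parallel to $A$, and let $R(Q)$ be its range. For any $x_0\in\mathcal H$ define the Douglas--Rachford sequence by $x_{n+1}:=T_{S,A}x_n$ for $n\ge 0$, where $T_{S,A}:=\frac{1}{2}(I+R_AR_S)$. Then $(x_n)_{n=1}^\infty$ converges in norm to a point $x$ with $x^+\in S\cap A$ whenever one of the following conditions holds: (a) $R(Q)\cap S=\{0\}$. (b) $Q(A-S)\subseteq S\cup(-S)$ and $Q(S)\subseteq S$. (c) $A$ has codimension $1$.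
   Context: All spaces are real. A partially ordered linear space is a pair $(X,K)$, with $K\subseteq X$ a pointed ($K\cap(-K)=\{0\}$) convex cone, ordered by $x\le_K y\iff y-x\in K$; it is a linear lattice if any two elements $x,y$ have a supremum $x\vee y$ and an infimum $x\wedge y$. Write $x^+:=x\vee 0$, $x^-:=(-x)\vee 0$, $|x|:=x\vee(-x)$. A Hilbert lattice is a linear lattice $(\mathcal H,\mathcal H^+)$ with $\mathcal H$ a Hilbert space whose norm satisfies $|x|\le|y|\Rightarrow\|x\|\le\|y\|$; its order cone is denoted $\mathcal H^+$ and called the lattice cone. For a nonempty closed convex set $C\subseteq\mathcal H$, $P_C$ is the nearest point projection onto $C$ and $R_C:=2P_C-I$ is the reflection with respect to $C$; $I$ is the identity. $A-S:=\{u-s:u\in A,\ s\in S\}$. *)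

theory Defs
  imports "HOL-Analysis.Analysis"
begin

section \<open>Partially ordered linear spaces and Hilbert lattices\<close>

text \<open>The order is a parameter: it is given by a cone, not by a type class.\<close>

definition cone_le :: "'a::real_vector set \<Rightarrow> 'a \<Rightarrow> 'a \<Rightarrow> bool"
  where "cone_le K x y \<longleftrightarrow> y - x \<in> K"

definition pointed_convex_cone :: "'a::real_vector set \<Rightarrow> bool"
  where "pointed_convex_cone K \<longleftrightarrow> convex_cone K \<and> K \<inter> uminus ` K = {0}"

definition is_cone_sup :: "'a::real_vector set \<Rightarrow> 'a \<Rightarrow> 'a \<Rightarrow> 'a \<Rightarrow> bool"
  where "is_cone_sup K x y z \<longleftrightarrow> cone_le K x z \<and> cone_le K y z \<and>
           (\<forall>w. cone_le K x w \<and> cone_le K y w \<longrightarrow> cone_le K z w)"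

definition is_cone_inf :: "'a::real_vector set \<Rightarrow> 'a \<Rightarrow> 'a \<Rightarrow> 'a \<Rightarrow> bool"
  where "is_cone_inf K x y z \<longleftrightarrow> cone_le K z x \<and> cone_le K z y \<and>
           (\<forall>w. cone_le K w x \<and> cone_le K w y \<longrightarrow> cone_le K w z)"

definition linear_lattice :: "'a::real_vector set \<Rightarrow> bool"
  where "linear_lattice K \<longleftrightarrow> pointed_convex_cone K \<and>
           (\<forall>x y. (\<exists>z. is_cone_sup K x y z) \<and> (\<exists>z. is_cone_inf K x y z))"

definition cone_sup :: "'a::real_vector set \<Rightarrow> 'a \<Rightarrow> 'a \<Rightarrow> 'a"
  where "cone_sup K x y = (THE z. is_cone_sup K x y z)"

lemma is_cone_sup_unique:
  assumes "pointed_convex_cone K" "is_cone_sup K x y z" "is_cone_sup K x y w"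
  shows "z = w"
proof -
  have "w - z \<in> K" "z - w \<in> K"
    using assms(2,3) by (auto simp: is_cone_sup_def cone_le_def)
  then have "w - z \<in> K \<inter> uminus ` K"
    by (metis IntI imageI minus_diff_eq)
  then have "w - z = 0"
    using assms(1) unfolding pointed_convex_cone_def by blast
  then show ?thesis by simp
qed

lemma is_cone_sup_cone_sup:
  assumes "linear_lattice K"
  shows "is_cone_sup K x y (cone_sup K x y)"
proof -
  have "\<exists>!z. is_cone_sup K x y z"
    using assms is_cone_sup_unique unfolding linear_lattice_def by metis
  then show ?thesis
    unfolding cone_sup_def by (rule theI')
qed

definition pos_part :: "'a::real_vector set \<Rightarrow> 'a \<Rightarrow> 'a"
  where "pos_part K x = cone_sup K x 0"

definition cone_abs :: "'a::real_vector set \<Rightarrow> 'a \<Rightarrow> 'a"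
  where "cone_abs K x = cone_sup K x (- x)"

text \<open>Completeness of the Hilbert space is carried by the type class.\<close>

definition hilbert_lattice :: "'a::{real_inner,complete_space} set \<Rightarrow> bool"
  where "hilbert_lattice K \<longleftrightarrow> linear_lattice K \<and>
           (\<forall>x y. cone_le K (cone_abs K x) (cone_abs K y) \<longrightarrow> norm x \<le> norm y)"

section \<open>Projections, reflections and the Douglas--Rachford operator\<close>

text \<open>The library's \<open>closest_point\<close> requires a Heine--Borel type, which would
  force finite dimension, so the same definition is repeated without that constraint.\<close>

definition nearest_point :: "'a::real_inner set \<Rightarrow> 'a \<Rightarrow> 'a"
  where "nearest_point C x = (SOME p. p \<in> C \<and> (\<forall>c\<in>C. dist x p \<le> dist x c))"

definition reflection :: "'a::real_inner set \<Rightarrow> 'a \<Rightarrow> 'a"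
  where "reflection C x = 2 *\<^sub>R nearest_point C x - x"

definition douglas_rachford :: "'a::real_inner set \<Rightarrow> 'a set \<Rightarrow> 'a \<Rightarrow> 'a"
  where "douglas_rachford S A x = (1/2) *\<^sub>R (x + reflection A (reflection S x))"

section \<open>Affine subspaces\<close>

definition parallel_subspace :: "'a::real_vector set \<Rightarrow> 'a set"
  where "parallel_subspace A = {u - v |u v. u \<in> A \<and> v \<in> A}"

lemma parallel_subspace_unique:
  assumes "affine_parallel A L" "subspace L"
  shows "L = parallel_subspace A"
proof -
  obtain a where L: "L = (\<lambda>x. a + x) ` A"
    using assms(1) unfolding affine_parallel_def by blast
  show ?thesis
  proof
    show "L \<subseteq> parallel_subspace A"
    proof
      fix x assume x: "x \<in> L"
      then obtain u v where "u \<in> A" "x = a + u" "v \<in> A" "0 = a + v"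
        using L subspace_0[OF assms(2)] by auto
      then have "x = u - v" by (metis add_diff_cancel_left diff_zero)
      then show "x \<in> parallel_subspace A"
        unfolding parallel_subspace_def using \<open>u \<in> A\<close> \<open>v \<in> A\<close> by blast
    qed
    show "parallel_subspace A \<subseteq> L"
    proof
      fix x assume "x \<in> parallel_subspace A"
      then obtain u v where "u \<in> A" "v \<in> A" "x = (a + u) - (a + v)"
        unfolding parallel_subspace_def by auto
      then show "x \<in> L"
        using L subspace_diff[OF assms(2)] by blast
    qed
  qed
qed

text \<open>Codimension \<open>n\<close>: the parallel subspace has an algebraic complement
  \<open>span B\<close> of dimension \<open>n\<close>, i.e. the quotient by it has dimension \<open>n\<close>.\<close>

definition has_codimension :: "'a::real_vector set \<Rightarrow> nat \<Rightarrow> bool"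
  where "has_codimension A n \<longleftrightarrow>
           (\<exists>B. finite B \<and> card B = n \<and> independent B \<and>
                span B \<inter> parallel_subspace A = {0} \<and>
                {b + l |b l. b \<in> span B \<and> l \<in> parallel_subspace A} = UNIV)"

definition finite_codimension :: "'a::real_vector set \<Rightarrow> bool"
  where "finite_codimension A \<longleftrightarrow> (\<exists>n. has_codimension A n)"

definition normal_projection :: "'a::real_inner set \<Rightarrow> 'a \<Rightarrow> 'a"
  where "normal_projection A = nearest_point (orthogonal_comp (parallel_subspace A))"

end

theory Submission
  imports Defs
begin

text \<open>
  Self-duality of the lattice cone gives \<open>P\<^sub>S x = x\<^sup>+\<close> and \<open>R\<^sub>S x = \<bar>x\<bar>\<close>, while
  \<open>R\<^sub>A y = y - 2 Q y + 2 Q a\<close> for any \<open>a \<in> A\<close>.  One Douglas--Rachford step is therefore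
  \<open>x \<mapsto> x\<^sup>+ - q\<close> with \<open>q = Q \<bar>x\<bar> - Q a\<close> in the range \<open>N\<close> of \<open>Q\<close>, equivalently
  \<open>x \<mapsto> x + x\<^sup>- - q\<close>.  The correction \<open>q\<close> never leaves the finite-dimensional space \<open>N\<close>,
  so it is invisible in the component \<open>I - Q\<close>.

  The step is the average of the identity with a nonexpansive map that fixes \<open>S \<inter> A\<close>.  Hence the
  orbit is bounded, and it converges in norm as soon as some subsequence does
  (\<open>averaged_iteration_converges\<close>); at the limit \<open>y\<close>, a fixed point, \<open>y\<^sup>- \<in> N\<close> forces
  \<open>Q (y\<^sup>+) = Q a\<close>, i.e. \<open>y\<^sup>+ \<in> A\<close>.  Bounded sequences in \<open>N\<close> subconverge, so a norm limit
  of \<open>x\<^sub>n\<close> along a subsequence, taken modulo \<open>N\<close>, is enough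
  (\<open>converges_if_parallel_part_subconverges\<close>).

  That limit comes from monotonicity (or from the orbit being eventually constant): a chain in the cone whose norms converge is Cauchy
  (\<open>chain_convergent\<close>), since \<open>0 \<le> u \<le> v\<close> gives \<open>\<parallel>v - u\<parallel>\<^sup>2 \<le> \<parallel>v\<parallel>\<^sup>2 - \<parallel>u\<parallel>\<^sup>2\<close>.
  \<^item> If \<open>N \<inter> S = {0}\<close>, the chain consists of the partial sums \<open>s\<^sub>n\<close> of the negative parts
    \<open>x\<^sub>k\<^sup>-\<close>.  Modulo \<open>N\<close>, \<open>x\<^sub>n\<close> is \<open>x\<^sub>0 + s\<^sub>n\<close>; and by compactness of the unit sphere of
    \<open>N\<close> an element of \<open>S\<close> is controlled by its component orthogonal to \<open>N\<close>
    (\<open>parallel_part_coercive\<close>), so boundedness of the orbit bounds \<open>s\<^sub>n\<close>.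
  \<^item> If \<open>Q\<close> maps \<open>A - S\<close> into \<open>S \<union> (- S)\<close> and \<open>S\<close> into \<open>S\<close>, every correction \<open>q\<close> has a sign.
    Once \<open>q \<le> 0\<close> occurs, the iteration is stationary from two steps later on; if \<open>q \<ge> 0\<close> throughout,
    the positive parts \<open>x\<^sub>n\<^sup>+\<close> decrease.
  \<^item> In codimension one \<open>N\<close> is a line: it either meets \<open>S\<close> only in \<open>0\<close>, or it is spanned by an
    element of \<open>S\<close>, and then \<open>Q\<close> satisfies the second condition.
\<close>

section \<open>Nearest points in a Hilbert space\<close>

text \<open>
  The obtuse-angle condition makes \<open>p\<close> the unique minimiser: expanding the square shows that
  the squared distance from \<open>x\<close> to any \<open>c \<in> C\<close> exceeds the one to \<open>p\<close> by at least the square of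
  \<open>dist p c\<close>.  Uniqueness
  is what pins down the choice made in the definition of \<open>nearest_point\<close>.
\<close>

lemma nearest_point_eqI:
  assumes "p \<in> C" and "\<And>c. c \<in> C \<Longrightarrow> (x - p) \<bullet> (c - p) \<le> 0"
  shows "nearest_point C x = p"
proof -
  have key: "(dist x p)\<^sup>2 + (dist p c)\<^sup>2 \<le> (dist x c)\<^sup>2" if "c \<in> C" for c
  proof -
    have "(dist x c)\<^sup>2 = (dist x p)\<^sup>2 + (dist p c)\<^sup>2 - 2 * ((x - p) \<bullet> (c - p))"
      by (simp add: dist_norm power2_norm_eq_inner inner_simps inner_commute algebra_simps)
    then show ?thesis using assms(2)[OF that] by linarith
  qed
  have le: "dist x p \<le> dist x c" if "c \<in> C" for c
  proof -
    have "(dist x p)\<^sup>2 \<le> (dist x c)\<^sup>2"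
      using key[OF that] zero_le_power2[of "dist p c"] by linarith
    then show ?thesis by (rule power2_le_imp_le) simp
  qed
  have unique: "c = p" if c: "c \<in> C" "\<forall>d\<in>C. dist x c \<le> dist x d" for c
  proof -
    have "(dist x c)\<^sup>2 \<le> (dist x p)\<^sup>2"
      using c assms(1) by (intro power_mono) auto
    then have "(dist p c)\<^sup>2 \<le> 0" using key[OF c(1)] by linarith
    then show ?thesis by simp
  qed
  show ?thesis
    unfolding nearest_point_def
  proof (rule some_equality)
    show "p \<in> C \<and> (\<forall>c\<in>C. dist x p \<le> dist x c)" using le assms(1) by blast
  next
    fix c assume "c \<in> C \<and> (\<forall>d\<in>C. dist x c \<le> dist x d)"
    then show "c = p" using unique by blast
  qed
qed

text \<open>
  A minimising sequence is Cauchy: the midpoint of two of its members lies in \<open>C\<close>, hence has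
  distance at least \<open>d\<close> from \<open>x\<close>, and the parallelogram law then bounds the distance of the two.
\<close>

lemma exists_nearest_point:
  fixes C :: "'a::{real_inner,complete_space} set"
  assumes "convex C" "closed C" "C \<noteq> {}"
  shows "\<exists>p\<in>C. \<forall>c\<in>C. dist x p \<le> dist x c"
proof -
  define d where "d = infdist x C"
  have d0: "d \<ge> 0" unfolding d_def by (rule infdist_nonneg)
  have low: "d \<le> dist x c" if "c \<in> C" for c
    unfolding d_def using that by (rule infdist_le)
  have "\<exists>c\<in>C. dist x c < d + inverse (real (Suc n))" for n
    using cInf_lessD[of "dist x ` C" "d + inverse (real (Suc n))"] assms(3)
    by (auto simp: d_def infdist_notempty)
  then obtain u where u: "\<And>n. u n \<in> C" "\<And>n. dist x (u n) < d + inverse (real (Suc n))"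
    by metis
  have "(\<lambda>n. dist x (u n)) \<longlonglongrightarrow> d"
  proof (rule tendsto_sandwich[where f = "\<lambda>n. d" and h = "\<lambda>n. d + inverse (real (Suc n))"])
    show "(\<lambda>n. d + inverse (real (Suc n))) \<longlonglongrightarrow> d"
      using tendsto_add[OF tendsto_const LIMSEQ_inverse_real_of_nat, of d] by simp
    show "\<forall>\<^sub>F n in sequentially. d \<le> dist x (u n)"
      using u(1) low by simp
    show "\<forall>\<^sub>F n in sequentially. dist x (u n) \<le> d + inverse (real (Suc n))"
      using u(2) by (simp add: less_imp_le)
  qed (rule tendsto_const)
  then have lim: "(\<lambda>n. (dist x (u n))\<^sup>2) \<longlonglongrightarrow> d\<^sup>2"
    by (rule tendsto_power)
  have par: "(dist (u m) (u n))\<^sup>2 \<le> 2 * ((dist x (u m))\<^sup>2 - d\<^sup>2) + 2 * ((dist x (u n))\<^sup>2 - d\<^sup>2)" for m n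
  proof -
    define c where "c = (1/2) *\<^sub>R u m + (1/2) *\<^sub>R u n"
    have "c \<in> C" unfolding c_def using assms(1) u(1)[of m] u(1)[of n] by (intro convexD) auto
    then have "d\<^sup>2 \<le> (dist x c)\<^sup>2" using low d0 by (intro power_mono) auto
    moreover have "(dist (u m) (u n))\<^sup>2 + 4 * (dist x c)\<^sup>2 = 2 * (dist x (u m))\<^sup>2 + 2 * (dist x (u n))\<^sup>2"
      unfolding c_def dist_norm power2_norm_eq_inner
      by (simp add: inner_simps inner_commute algebra_simps)
    ultimately show ?thesis by simp
  qed
  have "Cauchy u"
  proof (rule metric_CauchyI)
    fix e :: real assume e: "e > 0"
    then have "d\<^sup>2 < d\<^sup>2 + e\<^sup>2 / 4" by simp
    then have "\<forall>\<^sub>F n in sequentially. (dist x (u n))\<^sup>2 < d\<^sup>2 + e\<^sup>2 / 4"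
      using order_tendstoD(2)[OF lim] by blast
    then obtain M where M: "\<And>n. n \<ge> M \<Longrightarrow> (dist x (u n))\<^sup>2 < d\<^sup>2 + e\<^sup>2 / 4"
      by (auto simp: eventually_sequentially)
    have "dist (u m) (u n) < e" if "m \<ge> M" "n \<ge> M" for m n
    proof -
      have arith: "p < c" if "p \<le> 2 * (a - q) + 2 * (b - q)" "a < q + c / 4" "b < q + c / 4"
        for p a b c q :: real
        using that by argo
      have "(dist (u m) (u n))\<^sup>2 < e\<^sup>2" by (rule arith[OF par M[OF that(1)] M[OF that(2)]])
      then show ?thesis by (rule power_less_imp_less_base) (use e in simp)
    qed
    then show "\<exists>M. \<forall>m\<ge>M. \<forall>n\<ge>M. dist (u m) (u n) < e" by blast
  qed
  then obtain p where p: "u \<longlonglongrightarrow> p" using Cauchy_convergent convergent_def by blast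
  have "p \<in> C" using assms(2) u(1) p by (rule closed_sequentially)
  moreover have "(dist x p)\<^sup>2 = d\<^sup>2"
    using lim tendsto_power[OF tendsto_dist[OF tendsto_const p]] by (rule LIMSEQ_unique[rotated])
  then have "dist x p = d" using d0 by simp
  ultimately show ?thesis using low by auto
qed

text \<open>
  The difference between \<open>x\<close> and its nearest point \<open>p\<close> in \<open>L\<close> is orthogonal to \<open>L\<close>: otherwise
  moving from \<open>p\<close> along some \<open>l \<in> L\<close> would bring the point closer to \<open>x\<close>.
\<close>

lemma closed_subspace_decomposition:
  fixes L :: "'a::{real_inner,complete_space} set"
  assumes "subspace L" "closed L"
  shows "\<exists>m\<in>orthogonal_comp L. x - m \<in> L"
proof -
  obtain p where p: "p \<in> L" "\<And>c. c \<in> L \<Longrightarrow> dist x p \<le> dist x c"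
    using exists_nearest_point[of L x] assms subspace_imp_convex subspace_0 by blast
  have "l \<bullet> (x - p) = 0" if l: "l \<in> L" for l
  proof (cases "l = 0")
    case False
    \<comment> \<open>the minimiser of the distance from \<open>x\<close> to \<open>p + t l\<close> over all real \<open>t\<close>\<close>
    define t where "t = (l \<bullet> (x - p)) / (l \<bullet> l)"
    have "p + t *\<^sub>R l \<in> L" using assms(1) p l by (simp add: subspace_add subspace_scale)
    then have "(dist x p)\<^sup>2 \<le> (dist x (p + t *\<^sub>R l))\<^sup>2" using p by (intro power_mono) auto
    also have "\<dots> = (dist x p)\<^sup>2 - 2 * t * (l \<bullet> (x - p)) + t\<^sup>2 * (l \<bullet> l)"
      unfolding dist_norm power2_norm_eq_inner
      by (simp add: inner_simps inner_commute algebra_simps power2_eq_square)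
    also have "\<dots> = (dist x p)\<^sup>2 - (l \<bullet> (x - p))\<^sup>2 / (l \<bullet> l)"
      using False by (simp add: t_def field_simps power2_eq_square)
    finally have "(l \<bullet> (x - p))\<^sup>2 / (l \<bullet> l) \<le> 0" by simp
    moreover have "l \<bullet> l > 0" using False by simp
    ultimately show ?thesis by (auto simp: divide_le_0_iff)
  qed simp
  then have "x - p \<in> orthogonal_comp L" by (simp add: orthogonal_comp_def orthogonal_def)
  then show ?thesis using p(1) by (intro bexI[of _ "x - p"]) auto
qed

text \<open>
  Bolzano--Weierstrass in a finite-dimensional subspace of an inner product space that may itself
  be infinite-dimensional.  With an orthogonal spanning set, Pythagoras keeps both the coefficient
  of one vector and the remainder bounded, so subsequences can be extracted one vector at a time.
\<close>

lemma span_bounded_convergent_subsequence: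
  fixes f :: "nat \<Rightarrow> 'a::real_inner"
  assumes "finite B" "\<And>n. f n \<in> span B" "bounded (range f)"
  shows "\<exists>l r. strict_mono (r :: nat \<Rightarrow> nat) \<and> (f \<circ> r) \<longlonglongrightarrow> l"
proof -
  have orth: "\<exists>l r. strict_mono (r :: nat \<Rightarrow> nat) \<and> (f \<circ> r) \<longlonglongrightarrow> l"
    if "finite C" "pairwise orthogonal C" "\<And>n. f n \<in> span C" "bounded (range f)"
    for C and f :: "nat \<Rightarrow> 'a"
    using that
  proof (induction C arbitrary: f rule: finite_induct)
    case empty
    then have "(f \<circ> id) \<longlonglongrightarrow> 0" by (simp add: o_def)
    then show ?case using strict_mono_id by blast
  next
    case (insert b C)
    have orthC: "pairwise orthogonal C"
      using insert.prems(1) by (rule pairwise_mono) auto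
    show ?case
    proof (cases "b = 0")
      case True
      then show ?thesis using insert.IH[OF orthC] insert.prems by simp
    next
      case False
      have "\<exists>k. f n - k *\<^sub>R b \<in> span C" for n
        using insert.prems(2)[of n] by (simp add: span_breakdown_eq)
      then obtain k where k: "\<And>n. f n - k n *\<^sub>R b \<in> span C" by metis
      define y where "y n = f n - k n *\<^sub>R b" for n
      have bC: "orthogonal b c" if "c \<in> C" for c
        using insert.prems(1) insert.hyps(2) that unfolding pairwise_def by auto
      have "orthogonal (k n *\<^sub>R b) (y n)" for n
        using orthogonal_to_span[OF k bC] by (simp add: y_def orthogonal_def)
      then have pyth: "(norm (f n))\<^sup>2 = (norm (k n *\<^sub>R b))\<^sup>2 + (norm (y n))\<^sup>2" for n
        using norm_add_Pythagorean[of "k n *\<^sub>R b" "y n"] by (simp add: y_def)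
      obtain M where M: "\<And>n. norm (f n) \<le> M"
        using insert.prems(3) by (auto simp: bounded_iff)
      have yf: "norm (y n) \<le> norm (f n)" and kf: "norm (k n *\<^sub>R b) \<le> norm (f n)" for n
        by (rule power2_le_imp_le; simp add: pyth)+
      have yM: "norm (y n) \<le> M" and kM: "norm (k n *\<^sub>R b) \<le> M" for n
        using order_trans[OF yf M] order_trans[OF kf M] by auto
      have "\<exists>l r. strict_mono (r :: nat \<Rightarrow> nat) \<and> (y \<circ> r) \<longlonglongrightarrow> l"
        using yM k by (intro insert.IH[OF orthC]) (auto simp: y_def bounded_iff)
      then obtain l r where r: "strict_mono (r :: nat \<Rightarrow> nat)" "(y \<circ> r) \<longlonglongrightarrow> l" by blast
      have "bounded (range (k \<circ> r))"
        using kM False by (auto simp: bounded_iff field_simps intro!: exI[of _ "M / norm b"])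
      then obtain t q where q: "strict_mono (q :: nat \<Rightarrow> nat)" "((k \<circ> r) \<circ> q) \<longlonglongrightarrow> t"
        using bounded_imp_convergent_subsequence by blast
      have "(\<lambda>n. (k \<circ> r \<circ> q) n *\<^sub>R b + (y \<circ> r \<circ> q) n) \<longlonglongrightarrow> t *\<^sub>R b + l"
        by (intro tendsto_add tendsto_scaleR tendsto_const q(2) LIMSEQ_subseq_LIMSEQ[OF r(2) q(1)])
      then have "(f \<circ> (r \<circ> q)) \<longlonglongrightarrow> t *\<^sub>R b + l"
        by (simp add: y_def o_def)
      then show ?thesis using r q strict_mono_o by blast
    qed
  qed
  obtain C where "finite C" "pairwise orthogonal C" "span C = span B"
    using basis_orthogonal[OF assms(1)] by blast
  then show ?thesis using orth[of C f] assms by auto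
qed

section \<open>Averaged iterations\<close>

text \<open>
  The parallelogram law applied to \<open>u - w\<close> and \<open>R u - w\<close>.  The extra term on the left is what
  makes the residuals \<open>u - R u\<close> of an averaged iteration square-summable.
\<close>

lemma averaged_fejer:
  fixes R :: "'a::real_inner \<Rightarrow> 'a"
  assumes "norm (R u - w) \<le> norm (u - w)"
  shows "(norm ((1/2) *\<^sub>R (u + R u) - w))\<^sup>2 + (norm (u - R u))\<^sup>2 / 4 \<le> (norm (u - w))\<^sup>2"
proof -
  have "(1/2) *\<^sub>R (u + R u) - w = (1/2) *\<^sub>R ((u - w) + (R u - w))"
  proof -
    have "(u - w) + (R u - w) = (u + R u) - 2 *\<^sub>R w" by (simp add: scaleR_2)
    then show ?thesis by (simp only: scaleR_diff_right) simp
  qed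
  moreover have "u - R u = (u - w) - (R u - w)" by simp
  moreover have "(norm ((1/2) *\<^sub>R (p + q)))\<^sup>2 + (norm (p - q))\<^sup>2 / 4
      = (norm p)\<^sup>2 / 2 + (norm q)\<^sup>2 / 2" for p q :: 'a
    by (simp add: power2_norm_eq_inner inner_simps inner_commute field_simps)
  ultimately have "(norm ((1/2) *\<^sub>R (u + R u) - w))\<^sup>2 + (norm (u - R u))\<^sup>2 / 4
      = (norm (u - w))\<^sup>2 / 2 + (norm (R u - w))\<^sup>2 / 2"
    by metis
  moreover have "(norm (R u - w))\<^sup>2 \<le> (norm (u - w))\<^sup>2"
    using assms by (intro power_mono) auto
  ultimately show ?thesis by linarith
qed

text \<open>
  Distances to a fixed point decrease, so the residuals \<open>x\<^sub>n - R x\<^sub>n\<close> tend to \<open>0\<close> and every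
  cluster point \<open>y\<close> is itself a fixed point.  The distances to \<open>y\<close> then decrease as well, and
  they tend to \<open>0\<close> along a subsequence.
\<close>

lemma averaged_iteration_converges:
  fixes R :: "'a::real_inner \<Rightarrow> 'a" and x :: "nat \<Rightarrow> 'a"
  assumes nonexp: "\<And>u v. norm (R u - R v) \<le> norm (u - v)"
    and step: "\<And>n. x (Suc n) = (1/2) *\<^sub>R (x n + R (x n))"
    and fixed: "R z = z"
    and sub: "strict_mono (r :: nat \<Rightarrow> nat)" "(x \<circ> r) \<longlonglongrightarrow> y"
  shows "R y = y" "x \<longlonglongrightarrow> y"
proof -
  have fejer: "(norm (x (Suc n) - w))\<^sup>2 + (norm (x n - R (x n)))\<^sup>2 / 4 \<le> (norm (x n - w))\<^sup>2"
    if "R w = w" for n w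
    unfolding step using nonexp[of "x n" w] that by (intro averaged_fejer) simp
  define d where "d n = (norm (x n - z))\<^sup>2" for n
  have gap: "(norm (x n - R (x n)))\<^sup>2 \<le> 4 * (d n - d (Suc n))" for n
    using fejer[OF fixed, of n] by (simp add: d_def)
  have "d (Suc n) \<le> d n" for n
    using order_trans[OF zero_le_power2 gap[of n]] by simp
  then have "decseq d" by (simp add: decseq_Suc_iff)
  then obtain D where D: "d \<longlonglongrightarrow> D"
    using decseq_convergent[of d 0] by (auto simp: d_def)
  have "(\<lambda>n. 4 * (d n - d (Suc n))) \<longlonglongrightarrow> 4 * (D - D)"
    by (intro tendsto_mult tendsto_const tendsto_diff D LIMSEQ_Suc)
  then have "(\<lambda>n. 4 * (d n - d (Suc n))) \<longlonglongrightarrow> 0" by simp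
  then have "(\<lambda>n. (norm (x n - R (x n)))\<^sup>2) \<longlonglongrightarrow> 0"
    by (rule Lim_null_comparison[rotated]) (use gap in simp)
  then have "(\<lambda>n. sqrt ((norm (x n - R (x n)))\<^sup>2)) \<longlonglongrightarrow> sqrt 0"
    by (rule tendsto_real_sqrt)
  then have gap_lim: "(\<lambda>n. x n - R (x n)) \<longlonglongrightarrow> 0"
    by (simp add: tendsto_norm_zero_iff)
  have 1: "(\<lambda>n. x (r n) - R (x (r n))) \<longlonglongrightarrow> 0"
    using LIMSEQ_subseq_LIMSEQ[OF gap_lim sub(1)] by (simp add: o_def)
  have xr: "(\<lambda>n. x (r n)) \<longlonglongrightarrow> y" using sub(2) by (simp add: o_def)
  have "(\<lambda>n. R (x (r n))) \<longlonglongrightarrow> R y"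
  proof (rule LIM_zero_cancel, rule Lim_null_comparison)
    show "\<forall>\<^sub>F n in sequentially. norm (R (x (r n)) - R y) \<le> norm (x (r n) - y)"
      using nonexp by simp
    show "(\<lambda>n. norm (x (r n) - y)) \<longlonglongrightarrow> 0"
      using xr by (simp add: LIM_zero tendsto_norm_zero)
  qed
  then have "(\<lambda>n. x (r n) - R (x (r n))) \<longlonglongrightarrow> y - R y" using xr by (intro tendsto_diff)
  then have "y - R y = 0" using 1 by (rule LIMSEQ_unique)
  then show Ry: "R y = y" by simp
  have "norm (x (Suc n) - y) \<le> norm (x n - y)" for n
  proof -
    have "(norm (x (Suc n) - y))\<^sup>2 \<le> (norm (x n - y))\<^sup>2"
      using fejer[OF Ry, of n] zero_le_power2[of "norm (x n - R (x n))"] by linarith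
    then show ?thesis by (rule power2_le_imp_le) simp
  qed
  then have dec: "decseq (\<lambda>n. norm (x n - y))" by (simp add: decseq_Suc_iff)
  then obtain D' where D': "(\<lambda>n. norm (x n - y)) \<longlonglongrightarrow> D'"
    using decseq_convergent[of "\<lambda>n. norm (x n - y)" 0] by auto
  have "(\<lambda>n. norm (x (r n) - y)) \<longlonglongrightarrow> D'" using LIMSEQ_subseq_LIMSEQ[OF D' sub(1)] by (simp add: o_def)
  moreover have "(\<lambda>n. norm (x (r n) - y)) \<longlonglongrightarrow> 0"
    using xr by (simp add: LIM_zero tendsto_norm_zero)
  ultimately have "D' = 0" by (rule LIMSEQ_unique)
  with D' have "(\<lambda>n. norm (x n - y)) \<longlonglongrightarrow> 0" by simp
  then have "(\<lambda>n. x n - y) \<longlonglongrightarrow> 0" by (rule tendsto_norm_zero_cancel)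
  then show "x \<longlonglongrightarrow> y" by (rule LIM_zero_cancel)
qed

section \<open>Hilbert lattices\<close>

locale hilbert_lattice_cone =
  fixes S :: "'a::{real_inner,complete_space} set"
  assumes hilbert_lattice: "hilbert_lattice S"
begin

abbreviation pos :: "'a \<Rightarrow> 'a" where "pos \<equiv> pos_part S"
definition neg :: "'a \<Rightarrow> 'a" where "neg x = pos x - x"
definition modulus :: "'a \<Rightarrow> 'a" where "modulus x = pos x + neg x"

lemma linear_lattice: "linear_lattice S"
  using hilbert_lattice by (simp add: hilbert_lattice_def)

lemma pointed_convex_cone: "pointed_convex_cone S"
  using linear_lattice by (simp add: linear_lattice_def)

lemma convex_cone: "convex_cone S"
  using pointed_convex_cone by (simp add: pointed_convex_cone_def)

lemma zero_mem: "0 \<in> S"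
  and add_mem: "\<And>x y. x \<in> S \<Longrightarrow> y \<in> S \<Longrightarrow> x + y \<in> S"
  and scale_mem: "\<And>x t. x \<in> S \<Longrightarrow> 0 \<le> t \<Longrightarrow> t *\<^sub>R x \<in> S"
  using convex_cone by (auto simp: convex_cone_iff)

lemma sum_mem: "(\<And>i. i \<in> I \<Longrightarrow> f i \<in> S) \<Longrightarrow> sum f I \<in> S"
  by (induction I rule: infinite_finite_induct) (auto intro: zero_mem add_mem)

lemma cone_sup_eqI: "is_cone_sup S x y z \<Longrightarrow> cone_sup S x y = z"
  using is_cone_sup_unique[OF pointed_convex_cone] is_cone_sup_cone_sup[OF linear_lattice] by blast

lemma pos_sup: "is_cone_sup S x 0 (pos x)"
  unfolding pos_part_def by (rule is_cone_sup_cone_sup[OF linear_lattice])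

lemma pos_mem: "pos x \<in> S" and neg_mem: "neg x \<in> S"
  using pos_sup[of x] by (auto simp: is_cone_sup_def cone_le_def neg_def)

lemma pos_least: "w - x \<in> S \<Longrightarrow> w \<in> S \<Longrightarrow> w - pos x \<in> S"
  using pos_sup[of x] by (simp add: is_cone_sup_def cone_le_def)

lemma modulus_mem: "modulus x \<in> S"
  unfolding modulus_def by (intro add_mem pos_mem neg_mem)

lemma pos_of_mem:
  assumes "x \<in> S" shows "pos x = x"
  unfolding pos_part_def using assms
  by (intro cone_sup_eqI) (auto simp: is_cone_sup_def cone_le_def zero_mem)

lemma modulus_of_mem: "x \<in> S \<Longrightarrow> modulus x = x"
  by (simp add: modulus_def neg_def pos_of_mem)

text \<open>
  An upper bound \<open>w\<close> of \<open>x\<close> and \<open>- x\<close> yields the upper bound \<open>(w + x) / 2\<close> of \<open>x\<close> and \<open>0\<close>,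
  which is how the supremum defining \<open>\<bar>x\<bar>\<close> reduces to the one defining \<open>x\<^sup>+\<close>.
\<close>

lemma cone_abs_eq_modulus: "cone_abs S x = modulus x"
  unfolding cone_abs_def
proof (rule cone_sup_eqI, unfold is_cone_sup_def cone_le_def, intro conjI allI impI)
  show "modulus x - x \<in> S"
    using scale_mem[OF neg_mem, of 2 x] by (simp add: modulus_def neg_def scaleR_2 algebra_simps)
  show "modulus x - - x \<in> S"
    using scale_mem[OF pos_mem, of 2 x] by (simp add: modulus_def neg_def scaleR_2 algebra_simps)
next
  fix w assume w: "w - x \<in> S \<and> w - - x \<in> S"
  have "(1/2) *\<^sub>R (w + x) - x = (1/2) *\<^sub>R (w - x)"
    by (simp add: algebra_simps flip: scaleR_add_left)
  then have "(1/2) *\<^sub>R (w + x) - pos x \<in> S"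
    using w by (intro pos_least) (auto intro!: scale_mem)
  then have "2 *\<^sub>R ((1/2) *\<^sub>R (w + x) - pos x) \<in> S" by (rule scale_mem) simp
  then show "w - modulus x \<in> S"
    by (simp add: modulus_def neg_def scaleR_2 algebra_simps)
qed

lemma norm_mono_modulus: "modulus y - modulus x \<in> S \<Longrightarrow> norm x \<le> norm y"
  using hilbert_lattice by (auto simp: hilbert_lattice_def cone_le_def cone_abs_eq_modulus)

lemma norm_mono: "x \<in> S \<Longrightarrow> y - x \<in> S \<Longrightarrow> norm x \<le> norm y"
  using norm_mono_modulus[of y x] add_mem[of x "y - x"] by (simp add: modulus_of_mem)

text \<open>
  Since \<open>\<bar>x - y\<bar> \<le> x + y\<close> for positive \<open>x\<close> and \<open>y\<close>, monotonicity of the norm gives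
  \<open>\<parallel>x - y\<parallel> \<le> \<parallel>x + y\<parallel>\<close>, and polarisation turns this into a sign for the inner product.
\<close>

lemma inner_nonneg:
  assumes "x \<in> S" "y \<in> S" shows "0 \<le> x \<bullet> y"
proof -
  have "is_cone_sup S (x - y) (- (x - y)) (modulus (x - y))"
    using is_cone_sup_cone_sup[OF linear_lattice, of "x - y" "- (x - y)"]
    by (simp add: cone_abs_def flip: cone_abs_eq_modulus)
  moreover have "x + y - (x - y) = 2 *\<^sub>R y" "x + y - - (x - y) = 2 *\<^sub>R x"
    by (simp_all add: scaleR_2)
  ultimately have "x + y - modulus (x - y) \<in> S"
    using assms by (auto simp: is_cone_sup_def cone_le_def scale_mem)
  then have "norm (x - y) \<le> norm (x + y)"
    using assms by (intro norm_mono_modulus) (simp add: modulus_of_mem add_mem)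
  then have "(norm (x - y))\<^sup>2 \<le> (norm (x + y))\<^sup>2" by (intro power_mono) auto
  then show ?thesis by (simp add: power2_norm_eq_inner inner_simps inner_commute)
qed

text \<open>
  The elements \<open>x = x\<^sup>+ - x\<^sup>-\<close> and \<open>\<bar>x\<bar> = x\<^sup>+ + x\<^sup>-\<close> have the same modulus, hence the same norm.
\<close>

lemma pos_neg_orthogonal: "pos x \<bullet> neg x = 0"
proof -
  have "modulus (modulus x) = modulus x" by (rule modulus_of_mem[OF modulus_mem])
  then have "norm (modulus x) = norm x"
    using zero_mem by (intro antisym norm_mono_modulus) auto
  then have "(norm (pos x + neg x))\<^sup>2 = (norm (pos x - neg x))\<^sup>2"
    by (simp add: modulus_def neg_def)
  then show ?thesis by (simp add: power2_norm_eq_inner inner_simps inner_commute)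
qed

text \<open>
  The cone is its own dual: if \<open>x\<close> has nonnegative inner product with all of \<open>S\<close>, testing against
  \<open>x\<^sup>-\<close> gives \<open>- \<parallel>x\<^sup>-\<parallel>\<^sup>2 \<ge> 0\<close>.  So \<open>S\<close> is an intersection of closed half-spaces.
\<close>

lemma closed_cone: "closed S"
proof -
  have "x \<in> S" if "\<forall>y\<in>S. 0 \<le> y \<bullet> x" for x
  proof -
    have "0 \<le> neg x \<bullet> (pos x - neg x)"
      using that neg_mem[of x] by (simp add: neg_def)
    then have "neg x \<bullet> neg x \<le> 0"
      using pos_neg_orthogonal[of x] by (simp add: inner_simps inner_commute)
    then have "neg x = 0" by (metis inner_ge_zero inner_eq_zero_iff antisym)
    then show ?thesis using pos_mem[of x] by (simp add: neg_def)
  qed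
  then have "S = (\<Inter>y\<in>S. {x. 0 \<le> y \<bullet> x})" using inner_nonneg by auto
  moreover have "closed (\<Inter>y\<in>S. {x. 0 \<le> y \<bullet> x})"
    by (intro closed_INT ballI closed_Collect_le continuous_intros)
  ultimately show ?thesis by simp
qed

lemma nearest_point_cone: "nearest_point S x = pos x"
proof (rule nearest_point_eqI[OF pos_mem])
  fix c assume "c \<in> S"
  then have "0 \<le> neg x \<bullet> c" by (intro inner_nonneg neg_mem)
  then show "(x - pos x) \<bullet> (c - pos x) \<le> 0"
    using pos_neg_orthogonal[of x] by (simp add: neg_def inner_simps inner_commute)
qed

lemma reflection_cone: "reflection S x = modulus x"
  by (simp add: reflection_def nearest_point_cone modulus_def neg_def scaleR_2)

text \<open>
  Passing from \<open>x - y\<close> to \<open>\<bar>x\<bar> - \<bar>y\<bar>\<close> flips the sign of the term \<open>x\<^sup>- - y\<^sup>-\<close>, whose inner product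
  with \<open>x\<^sup>+ - y\<^sup>+\<close> is nonpositive because only the mixed products survive.
\<close>

lemma modulus_nonexpansive: "norm (modulus x - modulus y) \<le> norm (x - y)"
proof -
  have "(norm (x - y))\<^sup>2 - (norm (modulus x - modulus y))\<^sup>2 = - 4 * ((pos x - pos y) \<bullet> (neg x - neg y))"
  proof -
    have "x - y = (pos x - pos y) - (neg x - neg y)"
      "modulus x - modulus y = (pos x - pos y) + (neg x - neg y)"
      by (simp_all add: neg_def modulus_def)
    then show ?thesis
      by (simp only:) (simp add: power2_norm_eq_inner inner_simps inner_commute algebra_simps)
  qed
  moreover have "0 \<le> pos x \<bullet> neg y" "0 \<le> pos y \<bullet> neg x"
    by (auto intro: inner_nonneg pos_mem neg_mem)
  then have "(pos x - pos y) \<bullet> (neg x - neg y) \<le> 0"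
    using pos_neg_orthogonal by (simp add: inner_simps)
  ultimately have "(norm (modulus x - modulus y))\<^sup>2 \<le> (norm (x - y))\<^sup>2" by linarith
  then show ?thesis by (rule power2_le_imp_le) simp
qed

text \<open>
  This is where the order produces norm convergence: \<open>0 \<le> u \<le> v\<close> implies
  \<open>\<parallel>v - u\<parallel>\<^sup>2 \<le> \<parallel>v\<parallel>\<^sup>2 - \<parallel>u\<parallel>\<^sup>2\<close>, so convergence of the norms makes the sequence Cauchy, whether
  it increases or decreases.
\<close>

lemma chain_convergent:
  fixes s :: "nat \<Rightarrow> 'a"
  assumes mem: "\<And>n. s n \<in> S"
    and chain: "\<And>m n. s n - s m \<in> S \<or> s m - s n \<in> S"
    and conv: "convergent (\<lambda>n. norm (s n))"
  shows "convergent s"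
proof -
  have le: "(norm (v - u))\<^sup>2 \<le> (norm v)\<^sup>2 - (norm u)\<^sup>2" if "u \<in> S" "v - u \<in> S" for u v
  proof -
    have "0 \<le> (v - u) \<bullet> u" using that by (intro inner_nonneg)
    then show ?thesis by (simp add: power2_norm_eq_inner inner_simps inner_commute)
  qed
  have key: "(norm (s m - s n))\<^sup>2 \<le> \<bar>(norm (s m))\<^sup>2 - (norm (s n))\<^sup>2\<bar>" for m n
    using chain[of n m] le[OF mem, of "s m" n] le[OF mem, of "s n" m]
    by (auto simp: norm_minus_commute)
  obtain l where "(\<lambda>n. norm (s n)) \<longlonglongrightarrow> l" using conv by (auto simp: convergent_def)
  then have "(\<lambda>n. (norm (s n))\<^sup>2) \<longlonglongrightarrow> l\<^sup>2" by (intro tendsto_power)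
  then have C: "Cauchy (\<lambda>n. (norm (s n))\<^sup>2)" by (rule LIMSEQ_imp_Cauchy)
  have "Cauchy s"
  proof (rule CauchyI)
    fix e :: real assume e: "0 < e"
    then obtain M where M: "\<And>m n. m \<ge> M \<Longrightarrow> n \<ge> M \<Longrightarrow> \<bar>(norm (s m))\<^sup>2 - (norm (s n))\<^sup>2\<bar> < e\<^sup>2"
      using CauchyD[OF C, of "e\<^sup>2"] by auto
    have "norm (s m - s n) < e" if "m \<ge> M" "n \<ge> M" for m n
      using order.strict_trans1[OF key M[OF that]]
      by (rule power_less_imp_less_base) (use e in simp)
    then show "\<exists>M. \<forall>m\<ge>M. \<forall>n\<ge>M. norm (s m - s n) < e" by blast
  qed
  then show ?thesis by (rule Cauchy_convergent)
qed

end


section \<open>Closed affine subspaces of finite codimension\<close>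

locale finite_codim_affine =
  fixes A :: "'a::{real_inner,complete_space} set"
  assumes closed: "closed A" and affine: "affine A"
    and finite_codim: "finite_codimension A" and nonempty: "A \<noteq> {}"
begin

abbreviation L :: "'a set" where "L \<equiv> parallel_subspace A"
abbreviation N :: "'a set" where "N \<equiv> orthogonal_comp L"
abbreviation Q :: "'a \<Rightarrow> 'a" where "Q \<equiv> normal_projection A"

lemma diff_mem_parallel_iff: "a \<in> A \<Longrightarrow> u - a \<in> L \<longleftrightarrow> u \<in> A"
proof
  assume a: "a \<in> A" and "u - a \<in> L"
  then obtain v w where "v \<in> A" "w \<in> A" "u - a = v - w"
    unfolding parallel_subspace_def by blast
  then show "u \<in> A"
    using mem_affine_3_minus[OF affine a, of v w 1] by (metis diff_add_cancel add.commute scaleR_one)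
qed (auto simp: parallel_subspace_def)

lemma parallel_eq_vimage: "a \<in> A \<Longrightarrow> L = (\<lambda>v. a + v) -` A"
  using diff_mem_parallel_iff[of a "a + v" for v] by auto

lemma subspace_parallel: "subspace L"
proof -
  obtain a where a: "a \<in> A" using nonempty by blast
  have "(\<lambda>v. a + v) -` A = (\<lambda>v. - a + v) ` A"
    by (auto simp: image_iff algebra_simps)
  then show ?thesis
    using affine_diffs_subspace[OF affine a] parallel_eq_vimage[OF a] by simp
qed

lemma closed_parallel: "closed L"
proof -
  obtain a where a: "a \<in> A" using nonempty by blast
  show ?thesis unfolding parallel_eq_vimage[OF a]
    by (intro closed_vimage closed continuous_intros)
qed

lemma subspace_normal: "subspace N"
  by (rule subspace_orthogonal_comp)

lemma parallel_normal_orthogonal: "l \<in> L \<Longrightarrow> m \<in> N \<Longrightarrow> l \<bullet> m = 0"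
  by (simp add: orthogonal_comp_def orthogonal_def)

text \<open>
  An orthogonal decomposition determines the projection; linearity and contractivity of \<open>Q\<close> are
  read off from this.
\<close>

lemma Q_eqI:
  assumes "m \<in> N" "x - m \<in> L"
  shows "Q x = m"
  unfolding normal_projection_def
proof (rule nearest_point_eqI[OF assms(1)])
  fix c assume "c \<in> N"
  then have "(x - m) \<bullet> (c - m) = 0"
    using assms subspace_diff[OF subspace_normal] by (intro parallel_normal_orthogonal)
  then show "(x - m) \<bullet> (c - m) \<le> 0" by simp
qed

lemma Q_mem: "Q x \<in> N" and diff_Q_mem: "x - Q x \<in> L"
proof -
  obtain m where "m \<in> N" "x - m \<in> L"
    using closed_subspace_decomposition[OF subspace_parallel closed_parallel] by blast
  then show "Q x \<in> N" "x - Q x \<in> L" using Q_eqI by auto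
qed

lemma Q_of_normal: "m \<in> N \<Longrightarrow> Q m = m"
  by (rule Q_eqI) (auto intro: subspace_0[OF subspace_parallel])

lemma Q_of_parallel: "l \<in> L \<Longrightarrow> Q l = 0"
  by (rule Q_eqI) (auto intro: subspace_0[OF subspace_normal])

lemma range_Q: "range Q = N"
  using Q_mem Q_of_normal by (auto simp: image_iff) metis

lemma norm_Q_decomposition: "(norm x)\<^sup>2 = (norm (x - Q x))\<^sup>2 + (norm (Q x))\<^sup>2"
  using norm_add_Pythagorean[of "x - Q x" "Q x"] parallel_normal_orthogonal[OF diff_Q_mem Q_mem]
  by (simp add: orthogonal_def)

lemma norm_Q_le: "norm (Q x) \<le> norm x" and norm_diff_Q_le: "norm (x - Q x) \<le> norm x"
  by (rule power2_le_imp_le; simp add: norm_Q_decomposition[of x])+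

lemma bounded_linear_Q: "bounded_linear Q"
proof (rule bounded_linear_intro)
  fix x y :: 'a and t :: real
  have "x + y - (Q x + Q y) = (x - Q x) + (y - Q y)" by simp
  then show "Q (x + y) = Q x + Q y"
    by (metis Q_eqI Q_mem diff_Q_mem subspace_add subspace_normal subspace_parallel)
  have "t *\<^sub>R x - t *\<^sub>R Q x = t *\<^sub>R (x - Q x)" by (simp add: algebra_simps)
  then show "Q (t *\<^sub>R x) = t *\<^sub>R Q x"
    by (metis Q_eqI Q_mem diff_Q_mem subspace_scale subspace_normal subspace_parallel)
  show "norm (Q x) \<le> norm x * 1" using norm_Q_le by simp
qed

lemmas Q_linear = bounded_linear.linear[OF bounded_linear_Q]
lemmas Q_add = linear_add[OF Q_linear]
  and Q_diff = linear_diff[OF Q_linear]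
  and Q_neg = linear_neg[OF Q_linear]
  and Q_scale = linear_scale[OF Q_linear]
  and Q_zero = linear_0[OF Q_linear]

lemma Q_eq_iff: "a \<in> A \<Longrightarrow> Q u = Q a \<longleftrightarrow> u \<in> A"
proof
  assume a: "a \<in> A" and "Q u = Q a"
  then have "Q (u - a) = 0" by (simp add: Q_diff)
  then have "u - a \<in> L" using diff_Q_mem[of "u - a"] by simp
  then show "u \<in> A" using diff_mem_parallel_iff[OF a] by simp
next
  assume "a \<in> A" "u \<in> A"
  then have "u - a \<in> L" by (simp add: diff_mem_parallel_iff)
  then show "Q u = Q a" using Q_of_parallel[of "u - a"] by (simp add: Q_diff)
qed

text \<open>
  An algebraic complement \<open>span B\<close> of \<open>L\<close> is mapped by \<open>Q\<close> onto the orthogonal complement, as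
  \<open>Q\<close> annihilates \<open>L\<close> and is the identity on \<open>N\<close>.
\<close>

lemma normal_spanned_by_codimension:
  assumes "has_codimension A n"
  obtains B where "finite B" "card B = n" "N = span (Q ` B)"
proof -
  obtain B where B: "finite B" "card B = n" "{b + l |b l. b \<in> span B \<and> l \<in> L} = UNIV"
    using assms unfolding has_codimension_def by blast
  have "m \<in> span (Q ` B)" if "m \<in> N" for m
  proof -
    obtain b l where "b \<in> span B" "l \<in> L" "m = b + l" using B(3) by blast
    then have "m = Q b" using Q_of_normal[OF that] Q_of_parallel by (metis Q_add add.right_neutral)
    then show ?thesis using \<open>b \<in> span B\<close> linear_span_image[OF Q_linear, of B] by auto
  qed
  moreover have "span (Q ` B) \<subseteq> N"
    using Q_mem by (intro span_minimal subspace_normal) auto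
  ultimately show thesis using that B by blast
qed

lemma normal_bounded_convergent_subsequence:
  assumes "\<And>n. f n \<in> N" "bounded (range f)"
  shows "\<exists>l r. strict_mono (r :: nat \<Rightarrow> nat) \<and> (f \<circ> r) \<longlonglongrightarrow> l"
proof -
  obtain B where "finite B" "N = span (Q ` B)"
    using finite_codim normal_spanned_by_codimension unfolding finite_codimension_def by metis
  then show ?thesis using assms by (intro span_bounded_convergent_subsequence[of "Q ` B"]) auto
qed

lemma reflection_affine:
  assumes "a \<in> A" shows "reflection A y = y - 2 *\<^sub>R Q y + 2 *\<^sub>R Q a"
proof -
  have "nearest_point A y = y - Q y + Q a"
  proof (rule nearest_point_eqI)
    show mem: "y - Q y + Q a \<in> A"
      using Q_eq_iff[OF assms, of "y - Q y + Q a"] by (simp add: Q_add Q_diff Q_of_normal[OF Q_mem])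
    fix c assume "c \<in> A"
    then have "(c - (y - Q y + Q a)) \<bullet> (Q y - Q a) = 0"
      using mem by (intro parallel_normal_orthogonal)
        (auto simp: diff_mem_parallel_iff intro!: subspace_diff[OF subspace_normal] Q_mem)
    then show "(y - (y - Q y + Q a)) \<bullet> (c - (y - Q y + Q a)) \<le> 0"
      by (simp add: inner_commute)
  qed
  then show ?thesis by (simp add: reflection_def scaleR_2)
qed

text \<open>
  With \<open>w = y - z\<close>, the reflection only changes the sign of the component \<open>Q w\<close>.
\<close>

lemma reflection_affine_isometry: "norm (reflection A y - reflection A z) = norm (y - z)"
proof -
  obtain a where a: "a \<in> A" using nonempty by blast
  let ?w = "y - z"
  have "reflection A y - reflection A z = (?w - Q ?w) - Q ?w"
    unfolding reflection_affine[OF a] by (simp add: Q_diff scaleR_2)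
  moreover have "(norm ((?w - Q ?w) - Q ?w))\<^sup>2 = (norm ?w)\<^sup>2"
    using norm_add_Pythagorean[of "?w - Q ?w" "- Q ?w"] norm_Q_decomposition[of ?w]
      parallel_normal_orthogonal[OF diff_Q_mem[of ?w] Q_mem[of ?w]]
    by (simp add: orthogonal_def)
  ultimately show ?thesis by (metis norm_ge_zero power2_eq_iff_nonneg)
qed

end

section \<open>The Douglas--Rachford iteration\<close>

locale lattice_douglas_rachford = hilbert_lattice_cone S + finite_codim_affine A
  for S A :: "'a::{real_inner,complete_space} set" +
  fixes x :: "nat \<Rightarrow> 'a"
  assumes feasible: "S \<inter> A \<noteq> {}"
    and step: "\<And>n. x (Suc n) = douglas_rachford S A (x n)"
begin

text \<open>
  The correction subtracted from the positive part in one step, \<open>Q \<bar>y\<bar> - Q a\<close>; as \<open>Q\<close> is constant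
  on \<open>A\<close>, it depends only on \<open>y\<close>.  It vanishes exactly when \<open>\<bar>y\<bar> \<in> A\<close>.
\<close>

definition defect :: "'a \<Rightarrow> 'a" where
  "defect y = Q (modulus y) - Q (SOME a. a \<in> A)"

lemma defect_eq: "a \<in> A \<Longrightarrow> defect y = Q (modulus y) - Q a"
  unfolding defect_def by (metis Q_eq_iff someI)

lemma defect_mem: "defect y \<in> N"
  unfolding defect_def by (intro subspace_diff[OF subspace_normal] Q_mem)

lemma douglas_rachford_eq: "douglas_rachford S A y = pos y - defect y"
proof -
  obtain a where a: "a \<in> A" using nonempty by blast
  have "y + modulus y = 2 *\<^sub>R pos y" by (simp add: modulus_def neg_def scaleR_2)
  moreover have "y + reflection A (reflection S y) = (y + modulus y) - 2 *\<^sub>R defect y"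
    by (simp add: reflection_cone reflection_affine[OF a] defect_eq[OF a] algebra_simps)
  ultimately show ?thesis
    by (simp add: douglas_rachford_def flip: scaleR_diff_right)
qed

lemma step_eq: "x (Suc n) = pos (x n) - defect (x n)"
  by (simp add: step douglas_rachford_eq)

text \<open>
  At a fixed point the negative part equals the defect, so it lies in \<open>N\<close> and is fixed by \<open>Q\<close>;
  it then cancels from the definition of the defect, leaving \<open>Q (y\<^sup>+) = Q a\<close>.
\<close>

lemma fixed_point_pos_mem:
  assumes "douglas_rachford S A y = y" shows "pos y \<in> S \<inter> A"
proof -
  obtain a where a: "a \<in> A" using nonempty by blast
  have neg: "neg y = defect y"
    using assms by (simp add: douglas_rachford_eq neg_def algebra_simps)
  then have Qneg: "Q (neg y) = neg y" by (simp add: Q_of_normal defect_mem)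
  note neg
  also have "defect y = Q (pos y) + Q (neg y) - Q a"
    by (simp add: defect_eq[OF a] modulus_def Q_add)
  finally have "Q (pos y) = Q a" unfolding Qneg by simp
  then show ?thesis using pos_mem Q_eq_iff[OF a] by blast
qed

lemma double_reflection_nonexpansive:
  "norm (reflection A (reflection S u) - reflection A (reflection S v)) \<le> norm (u - v)"
  by (simp add: reflection_affine_isometry reflection_cone modulus_nonexpansive)

lemma double_reflection_fixed: "z \<in> S \<Longrightarrow> z \<in> A \<Longrightarrow> reflection A (reflection S z) = z"
  by (simp add: reflection_cone modulus_of_mem reflection_affine)

lemma converges_if_subsequence_converges:
  assumes "strict_mono (r :: nat \<Rightarrow> nat)" "(x \<circ> r) \<longlonglongrightarrow> y"
  shows "x \<longlonglongrightarrow> y \<and> pos y \<in> S \<inter> A"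
proof -
  obtain z where z: "z \<in> S" "z \<in> A" using feasible by blast
  note conv = averaged_iteration_converges[where R = "\<lambda>u. reflection A (reflection S u)",
      OF double_reflection_nonexpansive step[unfolded douglas_rachford_def]
        double_reflection_fixed[OF z] assms]
  have "douglas_rachford S A y = y"
    unfolding douglas_rachford_def conv(1) by (simp flip: scaleR_2)
  then show ?thesis using conv(2) fixed_point_pos_mem by blast
qed

lemma bounded_orbit: "\<exists>M. \<forall>n. norm (x n) \<le> M"
proof -
  obtain z where z: "z \<in> S" "z \<in> A" using feasible by blast
  have dec: "norm (x (Suc n) - z) \<le> norm (x n - z)" for n
  proof -
    let ?R = "\<lambda>u. reflection A (reflection S u)"
    have "norm (?R (x n) - z) \<le> norm (x n - z)"
      using double_reflection_nonexpansive[of "x n" z] by (simp add: double_reflection_fixed[OF z])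
    then have "(norm (x (Suc n) - z))\<^sup>2 + (norm (x n - ?R (x n)))\<^sup>2 / 4 \<le> (norm (x n - z))\<^sup>2"
      unfolding step douglas_rachford_def by (rule averaged_fejer)
    then have "(norm (x (Suc n) - z))\<^sup>2 \<le> (norm (x n - z))\<^sup>2"
      using zero_le_power2[of "norm (x n - ?R (x n))"] by linarith
    then show ?thesis by (rule power2_le_imp_le) simp
  qed
  have "norm (x n - z) \<le> norm (x 0 - z)" for n
    by (induction n) (auto intro: order_trans[OF dec])
  then have "norm (x n) \<le> norm (x 0 - z) + norm z" for n
    using norm_triangle_sub[of "x n" z] by (smt (verit))
  then show ?thesis by blast
qed

text \<open>
  The orbit is bounded, so the terms \<open>w\<^sub>n\<close> are bounded in the finite-dimensional space \<open>N\<close> and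
  subconverge.  So norm convergence along a subsequence only has to be checked modulo \<open>N\<close>.
\<close>

lemma converges_if_parallel_part_subconverges:
  assumes r: "strict_mono (r :: nat \<Rightarrow> nat)"
    and lim: "(\<lambda>n. x (r n) - w n) \<longlonglongrightarrow> l"
    and w: "\<And>n. w n \<in> N"
  shows "\<exists>y. x \<longlonglongrightarrow> y \<and> pos y \<in> S \<inter> A"
proof -
  obtain M where M: "\<And>n. norm (x n) \<le> M" using bounded_orbit by blast
  obtain K where K: "\<And>n. norm (x (r n) - w n) \<le> K"
    using convergent_imp_Bseq[of "\<lambda>n. x (r n) - w n"] lim
    by (auto simp: convergent_def Bseq_def)
  have "norm (w n) \<le> M + K" for n
    using norm_triangle_ineq4[of "x (r n)" "x (r n) - w n"] M[of "r n"] K[of n] by simp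
  then have "bounded (range w)" by (auto simp: bounded_iff)
  then obtain m q where q: "strict_mono (q :: nat \<Rightarrow> nat)" "(w \<circ> q) \<longlonglongrightarrow> m"
    using normal_bounded_convergent_subsequence[of w] w by blast
  have "(\<lambda>n. ((\<lambda>n. x (r n) - w n) \<circ> q) n + (w \<circ> q) n) \<longlonglongrightarrow> l + m"
    by (intro tendsto_add q(2) LIMSEQ_subseq_LIMSEQ[OF lim q(1)])
  then have "(x \<circ> (r \<circ> q)) \<longlonglongrightarrow> l + m" by (simp add: o_def)
  then show ?thesis
    using converges_if_subsequence_converges[OF strict_mono_o[OF r q(1)]] by blast
qed

text \<open>
  If no such \<open>\<delta>\<close> existed, there would be unit vectors of \<open>S\<close> approaching \<open>N\<close>.  Their
  projections have a cluster point, which is then a unit vector in both \<open>N\<close> and the closed cone \<open>S\<close>.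
\<close>

lemma parallel_part_coercive:
  assumes "N \<inter> S = {0}"
  shows "\<exists>\<delta>>0. \<forall>s\<in>S. \<delta> * norm s \<le> norm (s - Q s)"
proof (rule ccontr)
  assume neg: "\<not> ?thesis"
  have "\<exists>u\<in>S. norm u = 1 \<and> norm (u - Q u) < inverse (real (Suc k))" for k
  proof -
    have "\<exists>s\<in>S. \<not> inverse (real (Suc k)) * norm s \<le> norm (s - Q s)"
      using neg by (metis inverse_positive_iff_positive of_nat_0_less_iff zero_less_Suc)
    then obtain s where s: "s \<in> S" "norm (s - Q s) < inverse (real (Suc k)) * norm s"
      by (auto simp: not_le)
    then have "s \<noteq> 0" by auto
    define u where "u = inverse (norm s) *\<^sub>R s"
    have "u - Q u = inverse (norm s) *\<^sub>R (s - Q s)"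
      by (simp add: u_def Q_scale scaleR_diff_right)
    then have quot: "norm (u - Q u) = norm (s - Q s) / norm s"
      by (simp only: norm_scaleR) (simp add: divide_inverse mult.commute)
    have "0 < norm s" using \<open>s \<noteq> 0\<close> by simp
    then have "norm (u - Q u) < inverse (real (Suc k))"
      using s(2) unfolding quot by (simp only: pos_divide_less_eq)
    moreover have "u \<in> S" "norm u = 1" using s(1) \<open>s \<noteq> 0\<close> by (simp_all add: u_def scale_mem)
    ultimately show ?thesis by blast
  qed
  then obtain u where u: "\<And>k. u k \<in> S" "\<And>k. norm (u k) = 1"
    "\<And>k. norm (u k - Q (u k)) < inverse (real (Suc k))"
    by metis
  have "bounded (range (\<lambda>k. Q (u k)))"
    using norm_Q_le u(2) by (auto simp: bounded_iff intro!: exI[of _ 1]) metis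
  then obtain m r where r: "strict_mono (r :: nat \<Rightarrow> nat)" "((\<lambda>k. Q (u k)) \<circ> r) \<longlonglongrightarrow> m"
    using normal_bounded_convergent_subsequence[of "\<lambda>k. Q (u k)"] Q_mem by blast
  have "(\<lambda>k. u k - Q (u k)) \<longlonglongrightarrow> 0"
    by (rule Lim_null_comparison[OF _ LIMSEQ_inverse_real_of_nat])
      (use u(3) in \<open>simp add: less_imp_le\<close>)
  then have "(\<lambda>k. ((\<lambda>k. u k - Q (u k)) \<circ> r) k + ((\<lambda>k. Q (u k)) \<circ> r) k) \<longlonglongrightarrow> 0 + m"
    by (intro tendsto_add r(2) LIMSEQ_subseq_LIMSEQ r(1))
  then have um: "(\<lambda>k. u (r k)) \<longlonglongrightarrow> m" by simp
  have "m \<in> S" by (rule closed_sequentially[OF closed_cone u(1) um])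
  have "(\<lambda>k. Q (u (r k))) \<longlonglongrightarrow> Q m" by (rule bounded_linear.tendsto[OF bounded_linear_Q um])
  moreover have "(\<lambda>k. Q (u (r k))) \<longlonglongrightarrow> m" using r(2) by (simp add: o_def)
  ultimately have "Q m = m" by (rule LIMSEQ_unique)
  then have "m \<in> N" using Q_mem by metis
  then have "m = 0" using assms \<open>m \<in> S\<close> by blast
  moreover have "norm m = 1" using tendsto_norm[OF um] by (simp add: u(2) LIMSEQ_const_iff)
  ultimately show False by simp
qed

text \<open>
  Each step adds the negative part and an element of \<open>N\<close>, so modulo \<open>N\<close> the orbit is the
  increasing sequence of partial sums of the negative parts.  Coercivity carries the bound on the
  orbit over to these sums, which therefore converge.
\<close>

lemma converges_if_normal_meets_cone_trivially:
  assumes "N \<inter> S = {0}"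
  shows "\<exists>y. x \<longlonglongrightarrow> y \<and> pos y \<in> S \<inter> A"
proof -
  define s where "s n = (\<Sum>k<n. neg (x k))" for n
  have s_mem: "s n \<in> S" for n unfolding s_def by (intro sum_mem neg_mem)
  have s_mono: "s n - s m \<in> S" if "m \<le> n" for m n
  proof -
    have "s n - s m = (\<Sum>k\<in>{m..<n}. neg (x k))"
      using sum.atLeastLessThan_concat[of 0 m n "\<lambda>k. neg (x k)"] that
      by (simp add: s_def atLeast0LessThan algebra_simps)
    then show ?thesis by (simp add: sum_mem neg_mem)
  qed
  have part: "x n - Q (x n) = (x 0 - Q (x 0)) + (s n - Q (s n))" for n
  proof (induction n)
    case 0
    then show ?case by (simp add: s_def Q_zero)
  next
    case (Suc n)
    have x_Suc: "x (Suc n) = x n + neg (x n) - defect (x n)" by (simp add: step_eq neg_def)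
    have s_Suc: "s (Suc n) = s n + neg (x n)" by (simp add: s_def)
    have "x (Suc n) - Q (x (Suc n)) = (x n - Q (x n)) + (neg (x n) - Q (neg (x n)))"
      unfolding x_Suc by (simp add: Q_add Q_diff Q_of_normal[OF defect_mem])
    also have "\<dots> = (x 0 - Q (x 0)) + (s (Suc n) - Q (s (Suc n)))"
      unfolding Suc.IH s_Suc by (simp add: Q_add)
    finally show ?case .
  qed
  obtain \<delta> where \<delta>: "\<delta> > 0" "\<And>u. u \<in> S \<Longrightarrow> \<delta> * norm u \<le> norm (u - Q u)"
    using parallel_part_coercive[OF assms] by blast
  obtain M where M: "\<And>n. norm (x n) \<le> M" using bounded_orbit by blast
  have bound: "norm (s n) \<le> 2 * M / \<delta>" for n
  proof -
    have "\<delta> * norm (s n) \<le> norm (s n - Q (s n))" by (rule \<delta>(2)[OF s_mem])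
    also have "s n - Q (s n) = (x n - Q (x n)) - (x 0 - Q (x 0))" using part[of n] by simp
    also have "norm \<dots> \<le> norm (x n - Q (x n)) + norm (x 0 - Q (x 0))" by (rule norm_triangle_ineq4)
    also have "\<dots> \<le> 2 * M"
      using norm_diff_Q_le[of "x n"] norm_diff_Q_le[of "x 0"] M[of n] M[of 0] by linarith
    finally show ?thesis using \<delta>(1) by (simp add: field_simps)
  qed
  have "convergent (\<lambda>n. norm (s n))"
  proof (rule Bseq_mono_convergent)
    show "Bseq (\<lambda>n. norm (s n))" using bound by (intro BseqI'[of _ "2 * M / \<delta>"]) simp
    show "\<forall>m n. m \<le> n \<longrightarrow> norm (s m) \<le> norm (s n)" using norm_mono s_mem s_mono by blast
  qed
  then have "convergent s" using s_mem s_mono nat_le_linear by (intro chain_convergent) blast+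
  then obtain l where l: "s \<longlonglongrightarrow> l" by (auto simp: convergent_def)
  have "(\<lambda>n. (x 0 - Q (x 0)) + (s n - Q (s n))) \<longlonglongrightarrow> (x 0 - Q (x 0)) + (l - Q l)"
    by (intro tendsto_intros l bounded_linear.tendsto[OF bounded_linear_Q l])
  then have "(\<lambda>n. x (id n) - Q (x n)) \<longlonglongrightarrow> (x 0 - Q (x 0)) + (l - Q l)"
    by (simp only: id_apply flip: part)
  then show ?thesis using Q_mem by (intro converges_if_parallel_part_subconverges[OF strict_mono_id])
qed

text \<open>
  The hypotheses give the defect a sign.  A nonpositive defect makes the next iterate positive;
  the defect after that is \<open>- Q (x\<^sub>n\<^sup>-)\<close>, so the iterate stays positive, and the subsequent
  defect is zero.  If all defects are nonnegative, \<open>x\<^sub>n\<^sup>+\<close> is an upper bound of both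
  \<open>x\<^sub>n\<^sub>+\<^sub>1 = x\<^sub>n\<^sup>+ - q\<^sub>n\<close> and \<open>0\<close>, so the positive parts decrease.
\<close>

lemma converges_if_normal_part_comparable:
  assumes comparable: "\<And>u s. u \<in> A \<Longrightarrow> s \<in> S \<Longrightarrow> Q (u - s) \<in> S \<union> uminus ` S"
    and positive: "\<And>s. s \<in> S \<Longrightarrow> Q s \<in> S"
  shows "\<exists>y. x \<longlonglongrightarrow> y \<and> pos y \<in> S \<inter> A"
proof -
  obtain a where a: "a \<in> A" using nonempty by blast
  have sign: "defect y \<in> S \<or> - defect y \<in> S" for y
  proof -
    have "Q (a - modulus y) = - defect y" by (simp add: defect_eq[OF a] Q_diff)
    then have "- defect y \<in> S \<union> uminus ` S" using comparable[OF a modulus_mem] by metis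
    then consider "- defect y \<in> S" | t where "t \<in> S" "- defect y = - t" by blast
    then show ?thesis by cases simp_all
  qed
  show ?thesis
  proof (cases "\<exists>n. - defect (x n) \<in> S")
    case True
    then obtain n where n: "- defect (x n) \<in> S" ..
    have x1: "x (Suc n) = pos (x n) - defect (x n)" by (rule step_eq)
    then have x1_mem: "x (Suc n) \<in> S" using add_mem[OF pos_mem n] by simp
    have d0: "defect (x n) = Q (pos (x n)) + Q (neg (x n)) - Q a"
      by (simp add: defect_eq[OF a] modulus_def Q_add)
    have "defect (x (Suc n)) = Q (x (Suc n)) - Q a"
      by (simp only: defect_eq[OF a] modulus_of_mem[OF x1_mem])
    also have "Q (x (Suc n)) = Q (pos (x n)) - defect (x n)"
      by (simp add: x1 Q_diff Q_of_normal[OF defect_mem])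
    finally have d1: "defect (x (Suc n)) = - Q (neg (x n))"
      by (simp add: d0)
    have x2: "x (Suc (Suc n)) = x (Suc n) + Q (neg (x n))"
      by (simp add: step_eq[of "Suc n"] d1 pos_of_mem[OF x1_mem])
    then have x2_mem: "x (Suc (Suc n)) \<in> S"
      using add_mem[OF x1_mem positive[OF neg_mem]] by simp
    have "Q (x (Suc (Suc n))) = Q a"
      using d1 unfolding defect_eq[OF a, of "x (Suc n)"] modulus_of_mem[OF x1_mem]
      by (simp add: x2 Q_add Q_of_normal[OF Q_mem] algebra_simps)
    then have "defect (x (Suc (Suc n))) = 0"
      by (simp add: defect_eq[OF a] modulus_of_mem[OF x2_mem])
    then have fixed: "douglas_rachford S A (x (Suc (Suc n))) = x (Suc (Suc n))"
      by (simp add: douglas_rachford_eq pos_of_mem[OF x2_mem])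
    have "x (Suc (Suc n) + k) = x (Suc (Suc n))" for k
    proof (induction k)
      case (Suc k)
      then show ?case by (simp only: add_Suc_right step[of "Suc (Suc n) + k"] fixed)
    qed simp
    then have "(x \<circ> (\<lambda>k. Suc (Suc n) + k)) \<longlonglongrightarrow> x (Suc (Suc n))" by (simp add: o_def del: add_Suc)
    moreover have "strict_mono (\<lambda>k. Suc (Suc n) + k)" by (simp add: strict_mono_def)
    ultimately show ?thesis using converges_if_subsequence_converges by blast
  next
    case False
    then have d: "defect (x n) \<in> S" for n using sign by blast
    have dec_Suc: "pos (x n) - pos (x (Suc n)) \<in> S" for n
      by (rule pos_least) (simp_all add: step_eq d pos_mem)
    have dec: "pos (x m) - pos (x n) \<in> S" if "m \<le> n" for m n
      using that
    proof (induction n rule: dec_induct)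
      case (step k)
      have "pos (x m) - pos (x (Suc k)) = (pos (x m) - pos (x k)) + (pos (x k) - pos (x (Suc k)))"
        by simp
      then show ?case using add_mem[OF step.IH dec_Suc[of k]] by simp
    qed (simp add: zero_mem)
    have "decseq (\<lambda>n. norm (pos (x n)))" using dec norm_mono pos_mem by (auto simp: decseq_def)
    then obtain t where "(\<lambda>n. norm (pos (x n))) \<longlonglongrightarrow> t"
      using decseq_convergent[of "\<lambda>n. norm (pos (x n))" 0] by auto
    then have "convergent (\<lambda>n. norm (pos (x n)))" by (rule convergentI)
    then have "convergent (\<lambda>n. pos (x n))"
      using dec pos_mem nat_le_linear by (intro chain_convergent) blast+
    then obtain l where "(\<lambda>n. pos (x n)) \<longlonglongrightarrow> l" by (auto simp: convergent_def)
    then have "(\<lambda>n. x (Suc n) - (- defect (x n))) \<longlonglongrightarrow> l" by (simp add: step_eq)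
    then show ?thesis
      by (rule converges_if_parallel_part_subconverges[rotated])
        (auto simp: strict_mono_Suc_iff subspace_neg[OF subspace_normal] defect_mem)
  qed
qed

text \<open>
  If the line \<open>N\<close> contains a nonzero \<open>c \<in> S\<close>, then \<open>Q y\<close> is the multiple of \<open>c\<close> whose coefficient
  has the sign of \<open>y \<bullet> c\<close>.  So \<open>Q y\<close> is always comparable with \<open>0\<close>, and it is positive for
  \<open>y \<in> S\<close> because the cone is self-dual.
\<close>

lemma converges_if_codimension_one:
  assumes "has_codimension A 1"
  shows "\<exists>y. x \<longlonglongrightarrow> y \<and> pos y \<in> S \<inter> A"
proof (cases "N \<inter> S = {0}")
  case True
  then show ?thesis by (rule converges_if_normal_meets_cone_trivially)
next
  case False
  then obtain c where c: "c \<in> N" "c \<in> S" "c \<noteq> 0"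
    using zero_mem subspace_0[OF subspace_normal] by blast
  obtain B where "card B = 1" "N = span (Q ` B)"
    using normal_spanned_by_codimension[OF assms] by metis
  then obtain b where b: "N = span {b}" by (auto simp: card_1_singleton_iff)
  have Q_eq: "Q y = ((y \<bullet> c) / (c \<bullet> c)) *\<^sub>R c" for y
  proof -
    obtain t where t: "c = t *\<^sub>R b" using c(1) b by (auto simp: span_singleton)
    obtain t' where t': "Q y = t' *\<^sub>R b" using Q_mem[of y] b by (auto simp: span_singleton)
    have Qy: "Q y = (t' / t) *\<^sub>R c" using t t' c(3) by auto
    have "y \<bullet> c = Q y \<bullet> c"
      using parallel_normal_orthogonal[OF diff_Q_mem c(1), of y] by (simp add: inner_simps)
    then show ?thesis using Qy c(3) by simp
  qed
  have pos: "Q y \<in> S" if "0 \<le> y \<bullet> c" for y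
    unfolding Q_eq using that c(2) by (intro scale_mem) auto
  have comparable: "Q y \<in> S \<union> uminus ` S" for y
  proof (cases "0 \<le> y \<bullet> c")
    case False
    then have "- Q y \<in> S" using pos[of "- y"] by (simp add: Q_neg)
    then show ?thesis by (intro UnI2 rev_image_eqI[of "- Q y"]) simp_all
  qed (simp add: pos)
  show ?thesis
    by (rule converges_if_normal_part_comparable) (use comparable pos inner_nonneg c(2) in blast)+
qed

end

theorem theorem3p12:
  fixes S A :: "'a::{real_inner,complete_space} set"
    and Q :: "'a \<Rightarrow> 'a"
    and x :: "nat \<Rightarrow> 'a"
    and x0 :: 'a
  assumes "hilbert_lattice S"
    and "closed A" and "affine A" and "finite_codimension A"
    and "S \<inter> A \<noteq> {}"
    and "Q = normal_projection A"
    and "x 0 = x0"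
    and "\<And>n. x (Suc n) = douglas_rachford S A (x n)"
    and "range Q \<inter> S = {0}
       \<or> (Q ` {u - s |u s. u \<in> A \<and> s \<in> S} \<subseteq> S \<union> uminus ` S \<and> Q ` S \<subseteq> S)
       \<or> has_codimension A 1"
  shows "\<exists>y. x \<longlonglongrightarrow> y \<and> pos_part S y \<in> S \<inter> A"
proof -
  interpret lattice_douglas_rachford S A x
    using assms(1-5,8) by unfold_locales auto
  from assms(9) consider
      (a) "range Q \<inter> S = {0}"
    | (b) "Q ` {u - s |u s. u \<in> A \<and> s \<in> S} \<subseteq> S \<union> uminus ` S" "Q ` S \<subseteq> S"
    | (c) "has_codimension A 1"
    by blast
  then show ?thesis
  proof cases
    case a
    then show ?thesis
      unfolding assms(6) range_Q by (rule converges_if_normal_meets_cone_trivially)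
  next
    case b
    then show ?thesis
      unfolding assms(6) by (intro converges_if_normal_part_comparable) blast+
  next
    case c
    then show ?thesis by (rule converges_if_codimension_one)
  qed
qed

end
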